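(* Let $n\ge2$ and let $D,S$ be the $n\times n$ clock and shift matrices defined in the context, regarded as generators of the complex Lie algebra $\mathfrak{sl}(n)$. The number $R(n)$ of independent relations between these generators satisfies $$R(n)\le\begin{cases}2&\text{for }n=2,\\ n^2-3&\text{for }n\ge3.\end{cases}$$
   Context: With $a=\exp(2\pi i/n)$: $D=\operatorname{diag}(1,a,a^2,\dots,a^{n-1})$, and $S$ is the $n\times n$ cyclic shift matrix with $S_{i,i+1}=1$ for $1\le i\le n-1$, $S_{n,1}=1$, all other entries $0$. The matrices $D,S$ generate $\mathfrak{sl}(n)=\mathfrak{sl}(n,\mathbb{C})$ as a Lie algebra. The number $R(n)$ of independent relations is the minimal number of elements of the free complex Lie algebra $F$ on two generators that generate, as an ideal, the kernel of the surjection $F\to\mathfrak{sl}(n)$ sending the two generators to $D$ and $S$. *)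

theory Defs
  imports "Jordan_Normal_Form.VS_Connect" "HOL-Library.Extended_Nat"
begin

section \<open>Lie algebras\<close>

text \<open>As for the library's vector spaces, the carrier is explicit, and the fields
  \<open>mult\<close> and \<open>one\<close> inherited from the ring record play no role.\<close>

record ('a, 'b) lie_algebra = "('a, 'b) module" +
  lie_bracket :: "['b, 'b] \<Rightarrow> 'b" (\<open>\<lbrakk>_,/ _\<rbrakk>\<index>\<close>)

locale lie_algebra = vectorspace K L
    for K :: "('a, 'c) ring_scheme" and L :: "('a, 'b, 'd) lie_algebra_scheme" (structure) +
  assumes bracket_closed:
      "x \<in> carrier L \<Longrightarrow> y \<in> carrier L \<Longrightarrow> \<lbrakk>x, y\<rbrakk> \<in> carrier L"
    and bracket_add_left:
      "x \<in> carrier L \<Longrightarrow> y \<in> carrier L \<Longrightarrow> z \<in> carrier L \<Longrightarrow>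
        \<lbrakk>x \<oplus> y, z\<rbrakk> = \<lbrakk>x, z\<rbrakk> \<oplus> \<lbrakk>y, z\<rbrakk>"
    and bracket_add_right:
      "x \<in> carrier L \<Longrightarrow> y \<in> carrier L \<Longrightarrow> z \<in> carrier L \<Longrightarrow>
        \<lbrakk>x, y \<oplus> z\<rbrakk> = \<lbrakk>x, y\<rbrakk> \<oplus> \<lbrakk>x, z\<rbrakk>"
    and bracket_smult_left:
      "c \<in> carrier K \<Longrightarrow> x \<in> carrier L \<Longrightarrow> y \<in> carrier L \<Longrightarrow>
        \<lbrakk>c \<odot> x, y\<rbrakk> = c \<odot> \<lbrakk>x, y\<rbrakk>"
    and bracket_smult_right:
      "c \<in> carrier K \<Longrightarrow> x \<in> carrier L \<Longrightarrow> y \<in> carrier L \<Longrightarrow>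
        \<lbrakk>x, c \<odot> y\<rbrakk> = c \<odot> \<lbrakk>x, y\<rbrakk>"
    and bracket_alternating:
      "x \<in> carrier L \<Longrightarrow> \<lbrakk>x, x\<rbrakk> = \<zero>"
    and jacobi:
      "x \<in> carrier L \<Longrightarrow> y \<in> carrier L \<Longrightarrow> z \<in> carrier L \<Longrightarrow>
        \<lbrakk>x, \<lbrakk>y, z\<rbrakk>\<rbrakk> \<oplus> \<lbrakk>y, \<lbrakk>z, x\<rbrakk>\<rbrakk> \<oplus> \<lbrakk>z, \<lbrakk>x, y\<rbrakk>\<rbrakk> = \<zero>"

locale lie_hom = L: lie_algebra K L + M: lie_algebra K M + linear_map K L M f
    for K :: "('a, 'c) ring_scheme" and L :: "('a, 'b, 'd) lie_algebra_scheme"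
      and M :: "('a, 'e, 'h) lie_algebra_scheme" and f +
  assumes hom_bracket:
      "x \<in> carrier L \<Longrightarrow> y \<in> carrier L \<Longrightarrow> f \<lbrakk>x, y\<rbrakk>\<^bsub>L\<^esub> = \<lbrakk>f x, f y\<rbrakk>\<^bsub>M\<^esub>"

definition lie_ideal :: "('a, 'c) ring_scheme \<Rightarrow> ('a, 'b, 'd) lie_algebra_scheme \<Rightarrow> 'b set \<Rightarrow> bool" where
  "lie_ideal K L I \<longleftrightarrow> VectorSpace.subspace K I L \<and>
     (\<forall>x\<in>carrier L. \<forall>u\<in>I. \<lbrakk>x, u\<rbrakk>\<^bsub>L\<^esub> \<in> I)"

definition generated_lie_ideal ::
    "('a, 'c) ring_scheme \<Rightarrow> ('a, 'b, 'd) lie_algebra_scheme \<Rightarrow> 'b set \<Rightarrow> 'b set" where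
  "generated_lie_ideal K L A = \<Inter>{I. lie_ideal K L I \<and> A \<subseteq> I}"

text \<open>The value is \<open>\<infinity>\<close> if \<open>I\<close> is not finitely generated as an ideal.\<close>

definition min_ideal_generators ::
    "('a, 'c) ring_scheme \<Rightarrow> ('a, 'b, 'd) lie_algebra_scheme \<Rightarrow> 'b set \<Rightarrow> enat" where
  "min_ideal_generators K L I =
     Inf {enat (card A) | A. finite A \<and> A \<subseteq> carrier L \<and> generated_lie_ideal K L A = I}"


section \<open>The free Lie algebra\<close>

text \<open>Formal Lie expressions in generators \<open>'g\<close> with scalars \<open>'k\<close>, modulo the congruence
  generated by the axioms of a Lie algebra.\<close>

datatype ('k, 'g) lie_term =
    Gen 'g
  | Zero
  | Add "('k, 'g) lie_term" "('k, 'g) lie_term"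
  | Smult 'k "('k, 'g) lie_term"
  | Bracket "('k, 'g) lie_term" "('k, 'g) lie_term"

inductive lie_eq :: "('k::field, 'g) lie_term \<Rightarrow> ('k, 'g) lie_term \<Rightarrow> bool" where
  refl: "lie_eq s s"
| sym: "lie_eq s t \<Longrightarrow> lie_eq t s"
| trans: "lie_eq s t \<Longrightarrow> lie_eq t u \<Longrightarrow> lie_eq s u"
| cong_add: "lie_eq s s' \<Longrightarrow> lie_eq t t' \<Longrightarrow> lie_eq (Add s t) (Add s' t')"
| cong_smult: "lie_eq s s' \<Longrightarrow> lie_eq (Smult c s) (Smult c s')"
| cong_bracket: "lie_eq s s' \<Longrightarrow> lie_eq t t' \<Longrightarrow> lie_eq (Bracket s t) (Bracket s' t')"
| add_assoc: "lie_eq (Add (Add s t) u) (Add s (Add t u))"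
| add_comm: "lie_eq (Add s t) (Add t s)"
| add_zero: "lie_eq (Add Zero s) s"
| add_neg: "lie_eq (Add (Smult (- 1) s) s) Zero"
| smult_add_right: "lie_eq (Smult c (Add s t)) (Add (Smult c s) (Smult c t))"
| smult_add_left: "lie_eq (Smult (c + d) s) (Add (Smult c s) (Smult d s))"
| smult_smult: "lie_eq (Smult (c * d) s) (Smult c (Smult d s))"
| smult_one: "lie_eq (Smult 1 s) s"
| brk_add_left: "lie_eq (Bracket (Add s t) u) (Add (Bracket s u) (Bracket t u))"
| brk_add_right: "lie_eq (Bracket s (Add t u)) (Add (Bracket s t) (Bracket s u))"
| brk_smult_left: "lie_eq (Bracket (Smult c s) t) (Smult c (Bracket s t))"
| brk_smult_right: "lie_eq (Bracket s (Smult c t)) (Smult c (Bracket s t))"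
| brk_self: "lie_eq (Bracket s s) Zero"
| brk_jacobi: "lie_eq (Add (Add (Bracket s (Bracket t u)) (Bracket t (Bracket u s)))
                           (Bracket u (Bracket s t))) Zero"

quotient_type (overloaded) ('k, 'g) free_lie = "('k::field, 'g) lie_term" / lie_eq
  by (rule equivpI) (auto intro: reflpI sympI transpI lie_eq.intros(1-3))

lift_definition fl_gen :: "'g \<Rightarrow> ('k::field, 'g) free_lie" is Gen .
lift_definition fl_zero :: "('k::field, 'g) free_lie" is Zero .
lift_definition fl_add :: "('k::field, 'g) free_lie \<Rightarrow> ('k, 'g) free_lie \<Rightarrow> ('k, 'g) free_lie"
  is Add by (rule cong_add)
lift_definition fl_smult :: "'k::field \<Rightarrow> ('k, 'g) free_lie \<Rightarrow> ('k, 'g) free_lie"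
  is Smult by (rule cong_smult)
lift_definition fl_bracket :: "('k::field, 'g) free_lie \<Rightarrow> ('k, 'g) free_lie \<Rightarrow> ('k, 'g) free_lie"
  is Bracket by (rule cong_bracket)

definition free_lie_algebra :: "('k::field, ('k, 'g) free_lie) lie_algebra" where
  "free_lie_algebra =
     \<lparr> carrier = UNIV, mult = (\<lambda>_ _. fl_zero), one = fl_zero, zero = fl_zero, add = fl_add,
       smult = fl_smult, lie_bracket = fl_bracket \<rparr>"

lemma free_lie_algebra_simps [simp]:
  "carrier free_lie_algebra = UNIV"
  "zero free_lie_algebra = fl_zero"
  "add free_lie_algebra = fl_add"
  "smult free_lie_algebra = fl_smult"
  "lie_bracket free_lie_algebra = fl_bracket"
  by (simp_all add: free_lie_algebra_def)

lemma lie_algebra_free: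
  "lie_algebra class_ring (free_lie_algebra :: ('k::field, ('k, 'g) free_lie) lie_algebra)"
proof -
  let ?F = "free_lie_algebra :: ('k, ('k, 'g) free_lie) lie_algebra"
  have grp: "abelian_group ?F"
  proof (rule abelian_groupI)
    fix x y z
    show "(x \<oplus>\<^bsub>?F\<^esub> y) \<oplus>\<^bsub>?F\<^esub> z = x \<oplus>\<^bsub>?F\<^esub> (y \<oplus>\<^bsub>?F\<^esub> z)"
      by simp (transfer, rule lie_eq.add_assoc)
    show "x \<oplus>\<^bsub>?F\<^esub> y = y \<oplus>\<^bsub>?F\<^esub> x"
      by simp (transfer, rule lie_eq.add_comm)
    show "\<zero>\<^bsub>?F\<^esub> \<oplus>\<^bsub>?F\<^esub> x = x"
      by simp (transfer, rule lie_eq.add_zero)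
    have "fl_add (fl_smult (- 1) x) x = fl_zero"
      by (transfer, rule lie_eq.add_neg)
    then show "\<exists>y\<in>carrier ?F. y \<oplus>\<^bsub>?F\<^esub> x = \<zero>\<^bsub>?F\<^esub>"
      by auto
  qed simp_all
  have "Module.module class_ring ?F"
  proof (rule moduleI[OF _ grp])
    show "cring (class_ring :: 'k ring)"
      by (rule class_cring.cring_axioms)
  qed (simp_all, (transfer, rule lie_eq.intros(7-))+)
  then have "vectorspace class_ring ?F"
    unfolding vectorspace_def using class_field by blast
  then show ?thesis
    by (intro lie_algebra.intro lie_algebra_axioms.intro)
      (simp_all, (transfer, rule lie_eq.intros(7-))+)
qed

primrec lie_eval :: "('k, 'b, 'd) lie_algebra_scheme \<Rightarrow> ('g \<Rightarrow> 'b) \<Rightarrow> ('k, 'g) lie_term \<Rightarrow> 'b" where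
  "lie_eval L f (Gen g) = f g"
| "lie_eval L f Zero = \<zero>\<^bsub>L\<^esub>"
| "lie_eval L f (Add s t) = lie_eval L f s \<oplus>\<^bsub>L\<^esub> lie_eval L f t"
| "lie_eval L f (Smult c s) = c \<odot>\<^bsub>L\<^esub> lie_eval L f s"
| "lie_eval L f (Bracket s t) = \<lbrakk>lie_eval L f s, lie_eval L f t\<rbrakk>\<^bsub>L\<^esub>"

lemma lie_eval_closed:
  assumes "lie_algebra (class_ring :: 'k::field ring) L" "range f \<subseteq> carrier L"
  shows "lie_eval L f t \<in> carrier L"
proof -
  interpret lie_algebra class_ring L by fact
  show ?thesis
    using assms(2) by (induction t) (auto intro: bracket_closed smult_closed)
qed

lemma lie_eval_cong:
  assumes "lie_algebra (class_ring :: 'k::field ring) L" "range f \<subseteq> carrier L" "lie_eq s t"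
  shows "lie_eval L f s = lie_eval L f t"
proof -
  interpret lie_algebra class_ring L by fact
  note [simp] = lie_eval_closed[OF assms(1,2)]
  have one: "1 \<odot>\<^bsub>L\<^esub> x = x" if "x \<in> carrier L" for x
    using Module.module.smult_one[OF module.module_axioms that] by simp
  have neg: "(- 1) \<odot>\<^bsub>L\<^esub> x \<oplus>\<^bsub>L\<^esub> x = \<zero>\<^bsub>L\<^esub>" if "x \<in> carrier L" for x
    using smult_l_distr[of "- 1" 1 x] smult_l_null[of x] one[of x] that by simp
  show ?thesis
    using assms(3)
  proof induction
    case (add_comm s t) then show ?case by (simp add: M.a_comm)
  next
    case (add_assoc s t u) then show ?case by (simp add: M.a_assoc)
  next
    case (smult_add_left c d s) then show ?case using smult_l_distr[of c d] by simp
  next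
    case (smult_smult c d s) then show ?case using smult_assoc1[of c d] by simp
  next
    case (smult_one s) then show ?case using one by simp
  qed (simp_all add: neg smult_r_distr bracket_add_left bracket_add_right
        bracket_smult_left bracket_smult_right bracket_alternating jacobi)
qed

text \<open>The universal property.\<close>

theorem free_lie_algebra_universal:
  fixes f :: "'g \<Rightarrow> 'b" and L :: "('k::field, 'b, 'd) lie_algebra_scheme"
  assumes L: "lie_algebra class_ring L" and f: "range f \<subseteq> carrier L"
  shows "\<exists>!h. lie_hom class_ring free_lie_algebra L h \<and> (\<forall>g. h (fl_gen g) = f g)"
proof -
  define h where "h x = lie_eval L f (rep_free_lie x)" for x
  have h: "h (abs_free_lie t) = lie_eval L f t" for t
    unfolding h_def
    by (rule lie_eval_cong[OF L f]) (rule Quotient3_rep_abs[OF Quotient3_free_lie lie_eq.refl])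
  have ops: "fl_gen g = abs_free_lie (Gen g)" "fl_zero = abs_free_lie Zero"
    "fl_add (abs_free_lie s) (abs_free_lie t) = abs_free_lie (Add s t)"
    "fl_smult c (abs_free_lie s) = abs_free_lie (Smult c s)"
    "fl_bracket (abs_free_lie s) (abs_free_lie t) = abs_free_lie (Bracket s t)"
    for g and s t :: "('k, 'g) lie_term" and c
    by (simp_all add: fl_gen.abs_eq fl_zero.abs_eq fl_add.abs_eq fl_smult.abs_eq fl_bracket.abs_eq
        fl_gen_def fl_zero_def)
  have surj: "\<exists>t. x = abs_free_lie t" for x :: "('k, 'g) free_lie"
    by (metis Quotient3_abs_rep[OF Quotient3_free_lie])
  have hom: "lie_hom class_ring free_lie_algebra L h"
  proof -
    have vs: "vectorspace class_ring L"
        "vectorspace class_ring (free_lie_algebra :: ('k, ('k, 'g) free_lie) lie_algebra)"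
      using L lie_algebra_free lie_algebra_def by blast+
    have closed: "h x \<in> carrier L" for x
      by (simp add: h_def lie_eval_closed[OF L f])
    have add: "h (fl_add x y) = h x \<oplus>\<^bsub>L\<^esub> h y" for x y
      using surj[of x] surj[of y] by (auto simp: ops h)
    have smult: "h (fl_smult c x) = c \<odot>\<^bsub>L\<^esub> h x" for c x
      using surj[of x] by (auto simp: ops h)
    have br: "h (fl_bracket x y) = \<lbrakk>h x, h y\<rbrakk>\<^bsub>L\<^esub>" for x y
      using surj[of x] surj[of y] by (auto simp: ops h)
    have "h \<in> LinearCombinations.module_hom class_ring free_lie_algebra L"
      unfolding LinearCombinations.module_hom_def by (auto simp: add smult closed)
    then have "linear_map class_ring free_lie_algebra L h"
      using vs unfolding linear_map_def mod_hom_def mod_hom_axioms_def vectorspace_def by blast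
    then show ?thesis
      using L lie_algebra_free unfolding lie_hom_def lie_hom_axioms_def by (auto simp: br)
  qed
  show ?thesis
  proof (rule ex1I[of _ h], intro conjI allI)
    show "lie_hom class_ring free_lie_algebra L h" by (rule hom)
    show "h (fl_gen g) = f g" for g by (simp add: ops h)
  next
    fix h'
    assume h': "lie_hom class_ring free_lie_algebra L h' \<and> (\<forall>g. h' (fl_gen g) = f g)"
    then interpret h': lie_hom class_ring free_lie_algebra L h' by blast
    have "h' (abs_free_lie t) = lie_eval L f t" for t
    proof (induction t)
      case (Gen g)
      then show ?case using h' by (simp add: ops[symmetric])
    next
      case Zero
      then show ?case using h'.f0_is_0 by (simp add: ops[symmetric])
    next
      case (Add s t)
      then show ?case
        using h'.f_add[of "abs_free_lie s" "abs_free_lie t"] by (simp add: ops)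
    next
      case (Smult c s)
      then show ?case
        using h'.f_smult[of c "abs_free_lie s"] by (simp add: ops)
    next
      case (Bracket s t)
      then show ?case
        using h'.hom_bracket[of "abs_free_lie s" "abs_free_lie t"] by (simp add: ops)
    qed
    then show "h' = h"
      by (intro ext) (metis h surj)
  qed
qed

text \<open>Well-defined by the universal property whenever \<open>L\<close> is a Lie algebra containing the
  elements \<open>f g\<close>.\<close>

definition free_lie_hom ::
    "('k::field, 'b, 'd) lie_algebra_scheme \<Rightarrow> ('g \<Rightarrow> 'b) \<Rightarrow> ('k, 'g) free_lie \<Rightarrow> 'b" where
  "free_lie_hom L f =
     (THE h. lie_hom class_ring free_lie_algebra L h \<and> (\<forall>g. h (fl_gen g) = f g))"


section \<open>The clock and shift matrices in \<open>sl(n)\<close>\<close>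

definition mat_trace :: "'a::comm_monoid_add mat \<Rightarrow> 'a" where
  "mat_trace A = (\<Sum>i<dim_row A. A $$ (i, i))"

definition sl :: "nat \<Rightarrow> (complex, complex mat) lie_algebra" where
  "sl n =
     \<lparr> carrier = {A \<in> carrier_mat n n. mat_trace A = 0}, mult = (*), one = 1\<^sub>m n,
       zero = 0\<^sub>m n n, add = (+), smult = (\<cdot>\<^sub>m), lie_bracket = (\<lambda>A B. A * B - B * A) \<rparr>"

lemma mat_trace_comm:
  fixes A B :: "complex mat"
  assumes "A \<in> carrier_mat n n" "B \<in> carrier_mat n n"
  shows "mat_trace (A * B) = mat_trace (B * A)"
proof -
  have "mat_trace (A * B) = (\<Sum>i<n. \<Sum>j<n. A $$ (i, j) * B $$ (j, i))"
    using assms by (simp add: mat_trace_def scalar_prod_def atLeast0LessThan)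
  also have "\<dots> = (\<Sum>j<n. \<Sum>i<n. B $$ (j, i) * A $$ (i, j))"
    by (subst sum.swap) (simp add: mult.commute)
  also have "\<dots> = mat_trace (B * A)"
    using assms by (simp add: mat_trace_def scalar_prod_def atLeast0LessThan)
  finally show ?thesis .
qed

lemma sl_simps [simp]:
  "carrier (sl n) = {A \<in> carrier_mat n n. mat_trace A = 0}"
  "zero (sl n) = 0\<^sub>m n n"
  "add (sl n) = (+)"
  "smult (sl n) = (\<cdot>\<^sub>m)"
  "lie_bracket (sl n) = (\<lambda>A B. A * B - B * A)"
  by (simp_all add: sl_def)

lemma lie_algebra_sl: "lie_algebra class_ring (sl n)"
proof -
  have tr: "mat_trace (A + B) = mat_trace A + mat_trace B"
      "mat_trace (A - B) = mat_trace A - mat_trace B"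
      "mat_trace (c \<cdot>\<^sub>m A) = c * mat_trace A"
    if "A \<in> carrier_mat n n" "B \<in> carrier_mat n n" for A B :: "complex mat" and c
    using that by (simp_all add: mat_trace_def sum.distrib sum_subtractf sum_distrib_left)
  have tr0: "mat_trace (0\<^sub>m n n :: complex mat) = 0"
    by (simp add: mat_trace_def)
  have grp: "abelian_group (sl n)"
  proof (rule abelian_groupI)
    fix x assume x: "x \<in> carrier (sl n)"
    have "(- 1) \<cdot>\<^sub>m x + x = 0\<^sub>m n n"
      using x by (intro eq_matI) auto
    then show "\<exists>y\<in>carrier (sl n). y \<oplus>\<^bsub>sl n\<^esub> x = \<zero>\<^bsub>sl n\<^esub>"
      using x by (intro bexI[of _ "(- 1) \<cdot>\<^sub>m x"]) (auto simp: tr)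
  qed (auto simp: tr tr0 comm_add_mat[of _ n n] assoc_add_mat[of _ n n])
  have "Module.module class_ring (sl n)"
  proof (rule moduleI[OF _ grp])
    show "cring (class_ring :: complex ring)"
      by (rule class_cring.cring_axioms)
  qed (auto simp: tr intro!: eq_matI simp: algebra_simps)
  then have "vectorspace class_ring (sl n)"
    unfolding vectorspace_def using class_field by blast
  moreover have "lie_algebra_axioms class_ring (sl n)"
  proof (rule lie_algebra_axioms.intro; simp only: sl_simps mem_Collect_eq; (elim conjE)?)
    fix x y z :: "complex mat" and c :: complex
    assume x: "x \<in> carrier_mat n n"
    show "x * x - x * x = 0\<^sub>m n n" using x by simp
    assume y: "y \<in> carrier_mat n n"
    show "x * y - y * x \<in> carrier_mat n n \<and> mat_trace (x * y - y * x) = 0"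
      using x y mat_trace_comm[OF x y] tr(2)[of "x * y" "y * x"]
      by (auto intro!: minus_carrier_mat mult_carrier_mat)
    show "c \<cdot>\<^sub>m x * y - y * (c \<cdot>\<^sub>m x) = c \<cdot>\<^sub>m (x * y - y * x)"
         "x * (c \<cdot>\<^sub>m y) - c \<cdot>\<^sub>m y * x = c \<cdot>\<^sub>m (x * y - y * x)"
      using x y by (auto intro!: eq_matI simp: mult_smult_distrib[of _ n n]
          mult_smult_assoc_mat[of _ n n] algebra_simps)
    assume z: "z \<in> carrier_mat n n"
    show "(x + y) * z - z * (x + y) = (x * z - z * x) + (y * z - z * y)"
      "x * (y + z) - (y + z) * x = (x * y - y * x) + (x * z - z * x)"
      using x y z by (auto intro!: eq_matI simp: add_mult_distrib_mat[of _ n n]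
          mult_add_distrib_mat[of _ n n] algebra_simps)
    have dist: "a * (b * c - c * b) - (b * c - c * b) * a =
        (a * b * c - a * c * b) - (b * c * a - c * b * a)"
      if "a \<in> carrier_mat n n" "b \<in> carrier_mat n n" "c \<in> carrier_mat n n"
      for a b c :: "complex mat"
      using that mult_minus_distrib_mat[of a n n "b * c" n "c * b"]
        minus_mult_distrib_mat[of "b * c" n n "c * b" a n]
      by (simp add: assoc_mult_mat[of _ n n _ n _ n] mult_carrier_mat[of _ n n])
    show "x * (y * z - z * y) - (y * z - z * y) * x + (y * (z * x - x * z) - (z * x - x * z) * y)
        + (z * (x * y - y * x) - (x * y - y * x) * z) = 0\<^sub>m n n"
      unfolding dist[OF x y z] dist[OF y z x] dist[OF z x y]
      using x y z by (intro eq_matI) auto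
  qed
  ultimately show ?thesis by (rule lie_algebra.intro)
qed

text \<open>Matrix indices start at \<open>0\<close>.\<close>

definition clock_mat :: "nat \<Rightarrow> complex mat" where
  "clock_mat n = mat n n (\<lambda>(i, j). if i = j then exp (2 * pi * \<i> / n) ^ i else 0)"

definition shift_mat :: "nat \<Rightarrow> complex mat" where
  "shift_mat n = mat n n (\<lambda>(i, j). if j = (i + 1) mod n then 1 else 0)"

datatype clock_shift = Clock | Shift

fun clock_shift_mat :: "nat \<Rightarrow> clock_shift \<Rightarrow> complex mat" where
  "clock_shift_mat n Clock = clock_mat n"
| "clock_shift_mat n Shift = shift_mat n"

lemma clock_shift_mat_in_sl:
  assumes "n \<ge> 2"
  shows "clock_shift_mat n g \<in> carrier (sl n)"
proof (cases g)
  case Clock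
  let ?a = "exp (2 * pi * \<i> / n) :: complex"
  have "?a ^ n = 1"
    using assms by (simp flip: exp_of_nat_mult)
  moreover have "?a \<noteq> 1"
  proof
    assume "?a = 1"
    moreover have "?a = cis (2 * pi / n)"
      by (simp add: cis_conv_exp mult.commute)
    ultimately have "cos (2 * pi / n) = 1"
      by (metis cis.sel(1) one_complex.sel(1))
    moreover have "cos (2 * pi / n) < cos 0"
      using assms by (intro cos_monotone_0_pi) (auto simp: field_simps)
    ultimately show False by simp
  qed
  ultimately have "(\<Sum>i<n. ?a ^ i) = 0"
    by (simp add: geometric_sum)
  then show ?thesis using Clock by (simp add: clock_mat_def mat_trace_def)
next
  case Shift
  have "i \<noteq> (i + 1) mod n" if "i < n" for i
    using that assms by (cases "i + 1 = n") auto
  then show ?thesis using Shift by (simp add: shift_mat_def mat_trace_def)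
qed

definition clock_shift_relations :: "nat \<Rightarrow> (complex, clock_shift) free_lie set" where
  "clock_shift_relations n =
     mod_hom.ker free_lie_algebra (sl n) (free_lie_hom (sl n) (clock_shift_mat n))"

definition num_relations :: "nat \<Rightarrow> enat" where
  "num_relations n = min_ideal_generators class_ring free_lie_algebra (clock_shift_relations n)"

end

theory Submission
  imports Defs
begin

text \<open>Lift each monomial \<open>D\<^sup>a S\<^sup>b\<close>, \<open>(a, b) \<noteq> (0, 0)\<close> modulo \<open>n\<close>, up to a nonzero scalar,
  to an iterated bracket \<open>t\<^sub>a\<^sub>b\<close> of the two generators of the free Lie algebra. In \<open>sl n\<close> the
  bracket of a generator with a monomial is a multiple of a monomial, so each pair of a generator
  and a lift gives one relation. If \<open>J\<close> is the ideal they generate, then \<open>J\<close> plus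
  the span of the lifts contains the generators and is stable under bracketing with them, hence is
  the whole free Lie algebra; since the monomials are linearly independent, \<open>J\<close> is the kernel.
  Of these \<open>2(n\<^sup>2 - 1)\<close> relations, many hold already in the free Lie algebra: the \<open>n\<^sup>2 - 3\<close> that
  define the lifts other than the generators, those from \<open>[D, D]\<close>, \<open>[S, S]\<close> and \<open>[D, S] = -[S, D]\<close>,
  and, if \<open>n \<ge> 3\<close>, the one from \<open>[S, [D, [S, D]]] = [D, [S, [S, D]]]\<close>, whose two sides differ by
  \<open>[[S, D], [S, D]] = 0\<close>.\<close>

section \<open>The free Lie algebra as a type-class vector space\<close>

text \<open>The whole quotient type is the carrier, so the type-class theory of spans and subspaces
  applies to it directly.\<close>

instantiation free_lie :: (field, type) ab_group_add
begin

definition zero_free_lie :: "('a, 'b) free_lie" where "zero_free_lie = fl_zero"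
definition plus_free_lie :: "('a, 'b) free_lie \<Rightarrow> ('a, 'b) free_lie \<Rightarrow> ('a, 'b) free_lie"
  where "plus_free_lie = fl_add"
definition uminus_free_lie :: "('a, 'b) free_lie \<Rightarrow> ('a, 'b) free_lie"
  where "uminus_free_lie = fl_smult (- 1)"
definition minus_free_lie :: "('a, 'b) free_lie \<Rightarrow> ('a, 'b) free_lie \<Rightarrow> ('a, 'b) free_lie"
  where "minus_free_lie x y = fl_add x (fl_smult (- 1) y)"

instance
proof
  fix a b c :: "('a, 'b) free_lie"
  show "a + b + c = a + (b + c)"
    unfolding plus_free_lie_def by transfer (rule lie_eq.add_assoc)
  show "a + b = b + a"
    unfolding plus_free_lie_def by transfer (rule lie_eq.add_comm)
  show "0 + a = a"
    unfolding plus_free_lie_def zero_free_lie_def by transfer (rule lie_eq.add_zero)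
  show "- a + a = 0"
    unfolding plus_free_lie_def zero_free_lie_def uminus_free_lie_def
    by transfer (rule lie_eq.add_neg)
  show "a - b = a + - b"
    unfolding plus_free_lie_def minus_free_lie_def uminus_free_lie_def by (rule HOL.refl)
qed

end

interpretation fl: Vector_Spaces.vector_space "fl_smult :: 'k::field \<Rightarrow> ('k, 'g) free_lie \<Rightarrow> _"
proof
  fix a b :: 'k and x y :: "('k, 'g) free_lie"
  show "fl_smult a (x + y) = fl_smult a x + fl_smult a y"
    unfolding plus_free_lie_def by transfer (rule lie_eq.smult_add_right)
  show "fl_smult (a + b) x = fl_smult a x + fl_smult b x"
    unfolding plus_free_lie_def by transfer (rule lie_eq.smult_add_left)
  show "fl_smult a (fl_smult b x) = fl_smult (a * b) x"
    by transfer (rule lie_eq.sym[OF lie_eq.smult_smult])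
  show "fl_smult 1 x = x"
    by transfer (rule lie_eq.smult_one)
qed

lemma fl_bracket_add_left: "fl_bracket (x + y) z = fl_bracket x z + fl_bracket y z"
  unfolding plus_free_lie_def by transfer (rule lie_eq.brk_add_left)

lemma fl_bracket_add_right: "fl_bracket x (y + z) = fl_bracket x y + fl_bracket x z"
  unfolding plus_free_lie_def by transfer (rule lie_eq.brk_add_right)

lemma fl_bracket_smult_left: "fl_bracket (fl_smult c x) y = fl_smult c (fl_bracket x y)"
  by transfer (rule lie_eq.brk_smult_left)

lemma fl_bracket_smult_right: "fl_bracket x (fl_smult c y) = fl_smult c (fl_bracket x y)"
  by transfer (rule lie_eq.brk_smult_right)

lemma fl_bracket_self [simp]: "fl_bracket x x = 0"
  unfolding zero_free_lie_def by transfer (rule lie_eq.brk_self)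

lemma fl_bracket_jacobi:
  "fl_bracket x (fl_bracket y z) + fl_bracket y (fl_bracket z x) + fl_bracket z (fl_bracket x y) = 0"
  unfolding zero_free_lie_def plus_free_lie_def by transfer (rule lie_eq.brk_jacobi)

lemma fl_bracket_zero_left [simp]: "fl_bracket 0 y = 0"
  using fl_bracket_add_left[of 0 0 y] by simp

lemma fl_bracket_zero_right [simp]: "fl_bracket x 0 = 0"
  using fl_bracket_add_right[of x 0 0] by simp

lemma fl_bracket_minus_right: "fl_bracket x (- y) = - fl_bracket x y"
  using fl_bracket_add_right[of x y "- y"] by (simp add: eq_neg_iff_add_eq_0 add.commute)

text \<open>Polarisation: expand \<open>[x + y, x + y] = 0\<close>.\<close>

lemma fl_bracket_anticommute: "fl_bracket x y = - fl_bracket y x"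
  using fl_bracket_self[of "x + y"]
  by (simp add: fl_bracket_add_left fl_bracket_add_right eq_neg_iff_add_eq_0 del: fl_bracket_self)
    (simp add: algebra_simps)

text \<open>The Jacobi identity read as \<open>ad x\<close> being a derivation. In this form it
  turns \<open>ad [x, y]\<close> into a commutator and also yields the one coincidence between
  lifts.\<close>

lemma fl_bracket_leibniz:
  "fl_bracket x (fl_bracket y z) = fl_bracket (fl_bracket x y) z + fl_bracket y (fl_bracket x z)"
  using fl_bracket_jacobi[of x y z] fl_bracket_anticommute[of "fl_bracket x y" z]
    fl_bracket_anticommute[of z x]
  by (simp add: fl_bracket_minus_right algebra_simps)

text \<open>Each element is the class of a Lie term, so this is structural induction on terms passed
  to the quotient.\<close>

lemma free_lie_induct [case_names gen zero add smult bracket]: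
  fixes x :: "('k::field, 'g) free_lie"
  assumes "\<And>g. P (fl_gen g)" "P 0" "\<And>x y. P x \<Longrightarrow> P y \<Longrightarrow> P (x + y)"
    "\<And>c x. P x \<Longrightarrow> P (fl_smult c x)" "\<And>x y. P x \<Longrightarrow> P y \<Longrightarrow> P (fl_bracket x y)"
  shows "P x"
proof -
  have ops: "fl_gen g = abs_free_lie (Gen g)" "fl_zero = abs_free_lie Zero"
    "fl_add (abs_free_lie s) (abs_free_lie t) = abs_free_lie (Add s t)"
    "fl_smult c (abs_free_lie s) = abs_free_lie (Smult c s)"
    "fl_bracket (abs_free_lie s) (abs_free_lie t) = abs_free_lie (Bracket s t)"
    for g and s t :: "('k, 'g) lie_term" and c
    by (simp_all add: fl_gen.abs_eq fl_zero.abs_eq fl_add.abs_eq fl_smult.abs_eq fl_bracket.abs_eq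
        fl_gen_def fl_zero_def)
  have "P (abs_free_lie t)" for t
    using assms
    by (induction t) (simp_all add: zero_free_lie_def plus_free_lie_def flip: ops)
  moreover obtain t where "x = abs_free_lie t"
    by (metis Quotient3_abs_rep[OF Quotient3_free_lie])
  ultimately show ?thesis by simp
qed

text \<open>Translates between the carrier-based ideals of the definitions and type-class
  subspaces.\<close>

lemma lie_ideal_free_iff:
  fixes I :: "('k::field, 'g) free_lie set"
  shows "lie_ideal class_ring free_lie_algebra I \<longleftrightarrow>
    fl.subspace I \<and> (\<forall>x. \<forall>u\<in>I. fl_bracket x u \<in> I)"
proof -
  interpret lie_algebra class_ring "free_lie_algebra :: ('k, ('k, 'g) free_lie) lie_algebra"
    by (rule lie_algebra_free)
  have "VectorSpace.subspace class_ring I free_lie_algebra \<longleftrightarrow> fl.subspace I"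
    unfolding VectorSpace.subspace_def submodule_def fl.subspace_def
    using module.module_axioms vectorspace_axioms
    by (auto simp: zero_free_lie_def plus_free_lie_def)
  then show ?thesis
    by (auto simp: lie_ideal_def)
qed


section \<open>Bounding the number of relations\<close>

text \<open>The lifts \<open>t\<close> span a complement of the kernel. Only the pairs in
  \<open>B\<close> cost an ideal generator: the bracket minus an element of the span with the same
  image. For the other pairs the bracket lies in the span without imposing anything.\<close>

lemma min_ideal_generators_ker_le:
  fixes h :: "('k::field, 'g) free_lie \<Rightarrow> 'b" and L :: "('k, 'b, 'd) lie_algebra_scheme"
    and t :: "'i \<Rightarrow> ('k, 'g) free_lie" and B :: "('g \<times> 'i) set"
  assumes hom: "lie_hom class_ring free_lie_algebra L h"
    and gens: "\<And>g. fl_gen g \<in> fl.span (t ` I)"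
    and inj: "\<And>x. x \<in> fl.span (t ` I) \<Longrightarrow> h x = \<zero>\<^bsub>L\<^esub> \<Longrightarrow> x = 0"
    and fin: "finite B"
    and good: "\<And>g i. i \<in> I \<Longrightarrow> (g, i) \<notin> B \<Longrightarrow> fl_bracket (fl_gen g) (t i) \<in> fl.span (t ` I)"
    and bad: "\<And>g i. (g, i) \<in> B \<Longrightarrow> \<exists>y\<in>fl.span (t ` I). h y = h (fl_bracket (fl_gen g) (t i))"
  shows "min_ideal_generators class_ring free_lie_algebra (mod_hom.ker free_lie_algebra L h)
    \<le> enat (card B)"
proof -
  interpret h: lie_hom class_ring free_lie_algebra L h by (rule hom)
  let ?V = "fl.span (t ` I)"
  define K where "K = {x. h x = \<zero>\<^bsub>L\<^esub>}"
  have ker: "mod_hom.ker free_lie_algebra L h = K"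
    by (simp add: h.ker_def K_def)
  have closed [simp]: "h x \<in> carrier L" for x
    using h.f_im by auto
  have h_add: "h (x + y) = h x \<oplus>\<^bsub>L\<^esub> h y" for x y
    using h.f_add[of x y] by (simp add: plus_free_lie_def)
  have h_zero: "h 0 = \<zero>\<^bsub>L\<^esub>"
    using h.f0_is_0 by (simp add: zero_free_lie_def)
  have h_smult: "h (fl_smult c x) = c \<odot>\<^bsub>L\<^esub> h x" for c x
    using h.f_smult[of c x] by simp
  have h_bracket: "h (fl_bracket x y) = \<lbrakk>h x, h y\<rbrakk>\<^bsub>L\<^esub>" for x y
    using h.hom_bracket[of x y] by simp
  have smult_zero: "c \<odot>\<^bsub>L\<^esub> \<zero>\<^bsub>L\<^esub> = \<zero>\<^bsub>L\<^esub>" for c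
    using h_smult[of c 0] by (simp add: h_zero)
  have bracket_zero: "\<lbrakk>h x, \<zero>\<^bsub>L\<^esub>\<rbrakk>\<^bsub>L\<^esub> = \<zero>\<^bsub>L\<^esub>" for x
    using h_bracket[of x 0] by (simp add: h_zero)
  have K: "fl.subspace K" "\<And>x u. u \<in> K \<Longrightarrow> fl_bracket x u \<in> K"
    by (auto simp: K_def fl.subspace_def h_add h_zero h_smult h_bracket smult_zero bracket_zero)
  from bad obtain y where y: "\<And>g i. (g, i) \<in> B \<Longrightarrow> y g i \<in> ?V"
      "\<And>g i. (g, i) \<in> B \<Longrightarrow> h (y g i) = h (fl_bracket (fl_gen g) (t i))"
    by metis
  define A where "A = (\<lambda>(g, i). fl_bracket (fl_gen g) (t i) - y g i) ` B"
  have "A \<subseteq> K"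
  proof
    fix a assume "a \<in> A"
    then obtain g i where gi: "(g, i) \<in> B" "a = fl_bracket (fl_gen g) (t i) - y g i"
      by (auto simp: A_def)
    then have "h (fl_bracket (fl_gen g) (t i)) = h a \<oplus>\<^bsub>L\<^esub> h (y g i)"
      by (simp flip: h_add)
    then have "h (y g i) = h a \<oplus>\<^bsub>L\<^esub> h (y g i)"
      using gi(1) y(2) by simp
    then have "h a = \<zero>\<^bsub>L\<^esub>"
      using h.M.M.add.r_cancel_one'[of "h (y g i)" "h a"] by simp
    then show "a \<in> K" by (simp add: K_def)
  qed
  have "K \<subseteq> J" if J: "lie_ideal class_ring free_lie_algebra J" "A \<subseteq> J" for J
  proof
    fix x assume "x \<in> K"
    \<comment> \<open>An ideal \<open>J\<close> containing \<open>A\<close> need not lie in the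
      kernel. Intersecting with \<open>K\<close> ensures that the \<open>J'\<close> part of a
      decomposition is killed by \<open>h\<close>.\<close>
    define J' where "J' = J \<inter> K"
    have J': "fl.subspace J'" "\<And>x u. u \<in> J' \<Longrightarrow> fl_bracket x u \<in> J'" "A \<subseteq> J'"
      using J K \<open>A \<subseteq> K\<close> by (auto simp: J'_def lie_ideal_free_iff intro: fl.subspace_inter)
    define W where "W = {u + v | u v. u \<in> J' \<and> v \<in> ?V}"
    have W: "fl.subspace W"
      unfolding W_def using J'(1) fl.subspace_span by (rule fl.subspace_sums)
    have J'W: "J' \<subseteq> W"
      unfolding W_def using fl.span_zero by (force intro: exI[of _ 0])
    have VW: "?V \<subseteq> W"
      unfolding W_def using fl.subspace_0[OF J'(1)] by (force intro: exI[of _ 0])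
    have gen_V: "fl_bracket (fl_gen g) v \<in> W" if "v \<in> ?V" for g v
      using that
    proof (induction rule: fl.span_induct)
      case base
      show ?case
        using W by (auto simp: fl.subspace_def fl_bracket_add_right fl_bracket_smult_right)
    next
      case (step v)
      then obtain i where i: "i \<in> I" "v = t i" by auto
      show ?case
      proof (cases "(g, i) \<in> B")
        case True
        then have "fl_bracket (fl_gen g) v - y g i \<in> J'"
          using J'(3) i by (auto simp: A_def)
        then have "(fl_bracket (fl_gen g) v - y g i) + y g i \<in> W"
          unfolding W_def using y(1)[OF True] by blast
        then show ?thesis by simp
      next
        case False
        then show ?thesis using good i VW by auto
      qed
    qed
    \<comment> \<open>Stability passes from generators to all elements because
      \<open>ad [x, y]\<close> is the commutator of \<open>ad x\<close> and
      \<open>ad y\<close>.\<close>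
    have stable: "fl_bracket x w \<in> W" if "w \<in> W" for x w
      using that
    proof (induction x arbitrary: w rule: free_lie_induct)
      case (gen g)
      then obtain u v where "w = u + v" "u \<in> J'" "v \<in> ?V" by (auto simp: W_def)
      moreover from this have "fl_bracket (fl_gen g) u \<in> W"
        using J'(2) J'W by blast
      ultimately show ?case
        using gen_V fl.subspace_add[OF W] by (simp add: fl_bracket_add_right)
    next
      case zero
      then show ?case using fl.subspace_0[OF W] by simp
    next
      case (add x y)
      then show ?case using fl.subspace_add[OF W] by (simp add: fl_bracket_add_left)
    next
      case (smult c x)
      then show ?case using fl.subspace_scale[OF W] by (simp add: fl_bracket_smult_left)
    next
      case (bracket x y)
      have "fl_bracket (fl_bracket x y) w =
          fl_bracket x (fl_bracket y w) - fl_bracket y (fl_bracket x w)"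
        by (simp add: fl_bracket_leibniz[of x y w])
      then show ?case
        using bracket fl.subspace_diff[OF W] by simp
    qed
    \<comment> \<open>\<open>W\<close> contains the generators and is closed under all operations,
      so it is the whole algebra.\<close>
    have "x \<in> W"
    proof (induction x rule: free_lie_induct)
      case (gen g)
      then show ?case using gens VW by blast
    qed (use W stable in \<open>auto simp: fl.subspace_def\<close>)
    then obtain u v where uv: "x = u + v" "u \<in> J'" "v \<in> ?V" by (auto simp: W_def)
    then have "h v = \<zero>\<^bsub>L\<^esub>"
      using \<open>x \<in> K\<close> h_add[of u v] by (simp add: K_def J'_def)
    then have "v = 0" using inj uv(3) by blast
    then show "x \<in> J" using uv by (simp add: J'_def)
  qed
  moreover have "lie_ideal class_ring free_lie_algebra K"
    using K by (simp add: lie_ideal_free_iff)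
  ultimately have "generated_lie_ideal class_ring free_lie_algebra A = K"
    unfolding generated_lie_ideal_def using \<open>A \<subseteq> K\<close> by blast
  then have "min_ideal_generators class_ring free_lie_algebra K \<le> enat (card A)"
    unfolding min_ideal_generators_def using fin by (intro Inf_lower) (auto simp: A_def)
  also have "card A \<le> card B"
    unfolding A_def using fin by (rule card_image_le)
  finally show ?thesis
    by (simp add: ker)
qed


section \<open>Monomials in the clock and shift matrices\<close>

definition unity_root :: "nat \<Rightarrow> complex" where
  "unity_root n = exp (2 * pi * \<i> / n)"

lemma unity_root_pow: "unity_root n ^ k = cis (2 * pi * k / n)"
proof -
  have "unity_root n = cis (2 * pi / n)"
    by (simp add: unity_root_def cis_conv_exp mult.commute)
  then show ?thesis by (simp add: DeMoivre field_simps)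
qed

lemma unity_root_pow_mod:
  assumes "n > 0"
  shows "unity_root n ^ (k mod n) = unity_root n ^ k"
proof -
  have "unity_root n ^ n = 1"
    using assms by (simp add: unity_root_pow)
  moreover have "unity_root n ^ k = (unity_root n ^ n) ^ (k div n) * unity_root n ^ (k mod n)"
    by (simp flip: power_mult power_add)
  ultimately show ?thesis by simp
qed

lemma unity_root_pow_eq_1_iff:
  assumes "n > 0"
  shows "unity_root n ^ k = 1 \<longleftrightarrow> n dvd k"
proof -
  have "inj_on (\<lambda>k. unity_root n ^ k) {..<n}"
    using bij_betw_roots_unity[OF assms] by (simp add: unity_root_pow bij_betw_def)
  then have "unity_root n ^ (k mod n) = unity_root n ^ 0 \<longleftrightarrow> k mod n = 0"
    using assms by (subst inj_on_eq_iff) auto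
  then show ?thesis
    by (simp add: unity_root_pow_mod[OF assms] dvd_eq_mod_eq_0)
qed

lemma unity_root_pow_cong:
  assumes "n > 0" "a mod n = b mod n"
  shows "unity_root n ^ a = unity_root n ^ b"
  using assms by (metis unity_root_pow_mod)

text \<open>Inversion of the discrete Fourier transform, by orthogonality of the characters of the
  cyclic group of order \<open>n\<close>.\<close>

lemma unity_root_fourier_zero:
  assumes "n > 0" and zero: "\<And>i. i < n \<Longrightarrow> (\<Sum>a=1..n. u a * unity_root n ^ (a * i)) = 0"
    and c: "c \<in> {1..n}"
  shows "u c = 0"
proof -
  let ?w = "unity_root n"
  \<comment> \<open>The factor \<open>?w ^ ((n - c) * i)\<close> stands for \<open>?w\<close> to the
    power \<open>- c * i\<close>, written with a natural exponent.\<close>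
  have "0 = (\<Sum>i<n. ?w ^ ((n - c) * i) * (\<Sum>a=1..n. u a * ?w ^ (a * i)))"
    using zero by simp
  also have "\<dots> = (\<Sum>i<n. \<Sum>a=1..n. u a * (?w ^ (n - c + a)) ^ i)"
    by (simp add: sum_distrib_left algebra_simps flip: power_mult power_add)
  also have "\<dots> = (\<Sum>a=1..n. \<Sum>i<n. u a * (?w ^ (n - c + a)) ^ i)"
    by (rule sum.swap)
  also have "\<dots> = (\<Sum>a=1..n. if a = c then u c * n else 0)"
  proof (rule sum.cong)
    fix a assume a: "a \<in> {1..n}"
    show "(\<Sum>i<n. u a * (?w ^ (n - c + a)) ^ i) = (if a = c then u c * n else 0)"
    proof (cases "a = c")
      case True
      then have "?w ^ (n - c + a) = 1"
        using a unity_root_pow_eq_1_iff[OF assms(1)] by simp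
      then show ?thesis using True by simp
    next
      case False
      have "\<not> n dvd n - c + a"
      proof
        assume "n dvd n - c + a"
        then obtain k where k: "n - c + a = n * k" by (auto simp: dvd_def)
        have "0 < n - c + a" "n - c + a < n * 2" using a c by auto
        then have "k = 1" unfolding k by simp
        then have "n - c + a = n" using k by simp
        then show False using False c unfolding atLeastAtMost_iff by arith
      qed
      then have "?w ^ (n - c + a) \<noteq> 1"
        using unity_root_pow_eq_1_iff[OF assms(1)] by simp
      moreover have "(?w ^ (n - c + a)) ^ n = 1"
        using unity_root_pow_eq_1_iff[OF assms(1)] by (simp flip: power_mult)
      ultimately have "(\<Sum>i<n. (?w ^ (n - c + a)) ^ i) = 0"
        by (simp add: geometric_sum)
      then show ?thesis using False by (simp flip: sum_distrib_left)
    qed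
  qed simp
  also have "\<dots> = u c * n" using c by simp
  finally show ?thesis using assms(1) by simp
qed

text \<open>This is \<open>D^a S^b\<close>. The entrywise form makes its dependence on
  \<open>a\<close> and \<open>b\<close> modulo \<open>n\<close> immediate.\<close>

definition clock_shift_monomial :: "nat \<Rightarrow> nat \<Rightarrow> nat \<Rightarrow> complex mat" where
  "clock_shift_monomial n a b =
     mat n n (\<lambda>(i, j). if j = (i + b) mod n then unity_root n ^ (a * i) else 0)"

lemma clock_shift_monomial_carrier [simp]: "clock_shift_monomial n a b \<in> carrier_mat n n"
  by (simp add: clock_shift_monomial_def)

lemma clock_shift_monomial_dim [simp]:
  "dim_row (clock_shift_monomial n a b) = n" "dim_col (clock_shift_monomial n a b) = n"
  by (simp_all add: clock_shift_monomial_def)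

lemma clock_shift_monomial_cong:
  assumes "n > 0" "a mod n = a' mod n" "b mod n = b' mod n"
  shows "clock_shift_monomial n a b = clock_shift_monomial n a' b'"
proof -
  have "(i + b) mod n = (i + b') mod n" for i
    using assms(3) by (rule mod_add_cong[OF HOL.refl])
  moreover have "unity_root n ^ (a * i) = unity_root n ^ (a' * i)" for i
    using assms(1) mod_mult_cong[OF assms(2) HOL.refl] by (rule unity_root_pow_cong)
  ultimately show ?thesis
    unfolding clock_shift_monomial_def by (intro cong_mat HOL.refl) simp
qed

lemma clock_mat_monomial: "clock_mat n = clock_shift_monomial n 1 0"
  by (auto simp: clock_mat_def clock_shift_monomial_def unity_root_def intro!: eq_matI)

lemma shift_mat_monomial: "shift_mat n = clock_shift_monomial n 0 1"
  by (auto simp: shift_mat_def clock_shift_monomial_def intro!: eq_matI)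

text \<open>The scalar comes from \<open>S D = w D S\<close> with \<open>w = unity_root n\<close>:
  moving \<open>D^c\<close> to the left past \<open>S^b\<close> costs
  \<open>w^(b c)\<close>.\<close>

lemma clock_shift_monomial_mult:
  "clock_shift_monomial n a b * clock_shift_monomial n c d =
     unity_root n ^ (b * c) \<cdot>\<^sub>m clock_shift_monomial n (a + c) (b + d)" (is "?l = ?r")
proof (rule eq_matI)
  fix i j assume "i < dim_row ?r" "j < dim_col ?r"
  then have ij: "i < n" "j < n" by simp_all
  let ?w = "unity_root n"
  have "?l $$ (i, j) =
      (\<Sum>k\<in>{0..<n}. clock_shift_monomial n a b $$ (i, k) * clock_shift_monomial n c d $$ (k, j))"
    using ij by (simp add: scalar_prod_def)
  also have "\<dots> = (\<Sum>k\<in>{0..<n}. (if k = (i + b) mod n then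
      ?w ^ (a * i) * (if j = (k + d) mod n then ?w ^ (c * k) else 0) else 0))"
    using ij by (intro sum.cong) (simp_all add: clock_shift_monomial_def)
  also have "\<dots> = ?w ^ (a * i) *
      (if j = ((i + b) mod n + d) mod n then ?w ^ (c * ((i + b) mod n)) else 0)"
    using ij by simp
  also have "((i + b) mod n + d) mod n = (i + (b + d)) mod n"
    by (simp add: mod_add_left_eq add.assoc)
  also have "?w ^ (c * ((i + b) mod n)) = ?w ^ (c * (i + b))"
    using ij by (intro unity_root_pow_cong) (simp_all add: mod_mult_right_eq)
  finally show "?l $$ (i, j) = ?r $$ (i, j)"
    using ij by (simp add: clock_shift_monomial_def algebra_simps flip: power_add)
qed simp_all

lemma clock_shift_monomial_bracket:
  "clock_shift_monomial n a b * clock_shift_monomial n c d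
     - clock_shift_monomial n c d * clock_shift_monomial n a b =
     (unity_root n ^ (b * c) - unity_root n ^ (d * a)) \<cdot>\<^sub>m clock_shift_monomial n (a + c) (b + d)"
  unfolding clock_shift_monomial_mult
  by (intro eq_matI) (simp_all add: add.commute[of c] add.commute[of d] algebra_simps)

section \<open>Lifts of the monomials to the free Lie algebra\<close>

abbreviation (input) ad_clock :: "(complex, clock_shift) free_lie \<Rightarrow> (complex, clock_shift) free_lie"
  where "ad_clock \<equiv> fl_bracket (fl_gen Clock)"

abbreviation (input) ad_shift :: "(complex, clock_shift) free_lie \<Rightarrow> (complex, clock_shift) free_lie"
  where "ad_shift \<equiv> fl_bracket (fl_gen Shift)"

text \<open>The exponent of \<open>D\<close> runs from \<open>1\<close> to \<open>n\<close>, so \<open>S\<close> has the index \<open>(n, 1)\<close>: then every lift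
  with exponent of \<open>S\<close> positive, except \<open>S\<close> itself, comes from row \<open>1\<close> by applying \<open>ad D\<close>.\<close>

definition monomial_indices :: "nat \<Rightarrow> (nat \<times> nat) set" where
  "monomial_indices n = {1..n} \<times> {..<n} - {(n, 0)}"

text \<open>\<open>ad S\<close> applied to \<open>D\<close> gives exponent \<open>1\<close> of
  \<open>D\<close>, and \<open>ad D\<close> then raises that exponent as long as
  \<open>b > 0\<close>. Since \<open>D\<close> commutes with its own powers, \<open>D^a\<close> for
  \<open>2 \<le> a < n\<close> is reached instead by one more \<open>ad S\<close> from
  \<open>b = n - 1\<close>, as \<open>S^n = 1\<close>.\<close>

fun monomial_lift :: "nat \<Rightarrow> nat \<times> nat \<Rightarrow> (complex, clock_shift) free_lie" where
  "monomial_lift n (a, b) =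
     (if b = 0 then
        if a = 1 then fl_gen Clock
        else ad_shift ((ad_clock ^^ (a - 1)) ((ad_shift ^^ (n - 1)) (fl_gen Clock)))
      else if (a, b) = (n, 1) then fl_gen Shift
      else (ad_clock ^^ (a - 1)) ((ad_shift ^^ b) (fl_gen Clock)))"

text \<open>The brackets whose relation is not automatic in the free Lie algebra.\<close>

definition relation_indices :: "nat \<Rightarrow> (clock_shift \<times> nat \<times> nat) set" where
  "relation_indices n =
     {Clock} \<times> ({2..<n} \<times> {0} \<union> {(n - 1, 1)} \<union> {n} \<times> {2..<n}) \<union>
     {Shift} \<times> ({(1, n - 1)} \<union> {n} \<times> {2..<n} \<union> ({2..<n} \<times> {..<n - 1} - {(2, 1)}))"

lemma finite_relation_indices: "finite (relation_indices n)"
  by (simp add: relation_indices_def)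

text \<open>With \<open>n = m + 2\<close>, the families \<open>X\<close>, \<open>Y\<close> (twice),
  \<open>Z\<close> and two single pairs give \<open>m + 2 * m + (m * (m + 1) - 1) + 2\<close>, which
  is \<open>n\<^sup>2 - 3\<close>. The \<open>- 1\<close> is the removed pair \<open>(2, 1)\<close>.
  For \<open>n = 2\<close> all families are empty, nothing is saved, and two pairs remain.\<close>

lemma card_relation_indices:
  assumes "n \<ge> 2"
  shows "card (relation_indices n) \<le> (if n = 2 then 2 else n\<^sup>2 - 3)"
proof -
  define X where "X = {2..<n} \<times> {0::nat}"
  define Y where "Y = {n} \<times> {2..<n}"
  define Z where "Z = {2..<n} \<times> {..<n - 1} - {(2, 1)}"
  have fin: "finite X" "finite Y" "finite Z" by (simp_all add: X_def Y_def Z_def)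
  have "relation_indices n = {Clock} \<times> (X \<union> {(n - 1, 1)} \<union> Y) \<union> {Shift} \<times> ({(1, n - 1)} \<union> Y \<union> Z)"
    by (simp add: relation_indices_def X_def Y_def Z_def)
  also have "card \<dots> \<le> card ({Clock} \<times> (X \<union> {(n - 1, 1)} \<union> Y)) + card ({Shift} \<times> ({(1, n - 1)} \<union> Y \<union> Z))"
    by (rule card_Un_le)
  also have "\<dots> = card (X \<union> {(n - 1, 1)} \<union> Y) + card ({(1, n - 1)} \<union> Y \<union> Z)"
    by (simp only: card_cartesian_product_singleton)
  also have "card (X \<union> {(n - 1, 1)} \<union> Y) \<le> card X + card {(n - 1, 1::nat)} + card Y"
    by (meson card_Un_le add_mono le_trans order_refl)
  also have "card ({(1, n - 1)} \<union> Y \<union> Z) \<le> card {(1::nat, n - 1)} + card Y + card Z"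
    by (meson card_Un_le add_mono le_trans order_refl)
  finally have le: "card (relation_indices n) \<le> card X + 2 * card Y + card Z + 2"
    by simp
  obtain m where m: "n = m + 2" using assms by (metis le_add_diff_inverse2)
  show ?thesis
  proof (cases "m = 0")
    case True
    then show ?thesis using le m by (simp add: X_def Y_def Z_def)
  next
    case False
    have "card Z = m * (m + 1) - 1"
      unfolding Z_def using False m by (subst card_Diff_singleton) auto
    moreover have "card X = m" "card Y = m" using m by (simp_all add: X_def Y_def)
    ultimately show ?thesis
      using le m False by (simp add: power2_eq_square algebra_simps)
  qed
qed

text \<open>The last three equations are the \<open>n\<^sup>2 - 3\<close> brackets that define the
  lifts other than the generators. The pair \<open>(n - 1, 1)\<close> is excluded because the lift
  at \<open>(n, 1)\<close> is \<open>S\<close> itself.\<close>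

lemma monomial_lift_eqs:
  assumes "n \<ge> 2"
  shows "monomial_lift n (1, 0) = fl_gen Clock"
    and "monomial_lift n (n, 1) = fl_gen Shift"
    and "b < n - 1 \<Longrightarrow> ad_shift (monomial_lift n (1, b)) = monomial_lift n (1, b + 1)"
    and "0 < a \<Longrightarrow> 0 < b \<Longrightarrow> a < n \<Longrightarrow> (a, b) \<noteq> (n - 1, 1) \<Longrightarrow>
      ad_clock (monomial_lift n (a, b)) = monomial_lift n (a + 1, b)"
    and "2 \<le> a \<Longrightarrow> a < n \<Longrightarrow> ad_shift (monomial_lift n (a, n - 1)) = monomial_lift n (a, 0)"
proof -
  show "ad_clock (monomial_lift n (a, b)) = monomial_lift n (a + 1, b)"
    if "0 < a" "0 < b" "a < n" "(a, b) \<noteq> (n - 1, 1)"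
  proof -
    obtain c where "a = Suc c" using \<open>0 < a\<close> by (cases a) auto
    then show ?thesis using that by auto
  qed
qed (use assms in auto)

text \<open>Leibniz applied to \<open>[S, [D, [S, D]]]\<close> leaves
  \<open>[[S, D], [S, D]] = 0\<close> as the extra term. For \<open>n = 2\<close> the index
  \<open>(2, 1)\<close> would denote \<open>S\<close>.\<close>

lemma ad_shift_monomial_lift_2_1:
  assumes "n \<ge> 3"
  shows "ad_shift (monomial_lift n (2, 1)) = monomial_lift n (2, 2)"
  using assms by (simp add: numeral_2_eq_2 fl_bracket_leibniz[of "fl_gen Shift" "fl_gen Clock"])

lemma fl_bracket_gen_lift_in_span:
  assumes n: "n \<ge> 2" and i: "i \<in> monomial_indices n" "(g, i) \<notin> relation_indices n"
  shows "fl_bracket (fl_gen g) (monomial_lift n i) \<in> fl.span (monomial_lift n ` monomial_indices n)"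
proof -
  note eqs = monomial_lift_eqs[OF n]
  have base: "monomial_lift n j \<in> fl.span (monomial_lift n ` monomial_indices n)"
    if "j \<in> monomial_indices n" for j
    using that by (intro fl.span_base imageI)
  obtain a b where ab: "i = (a, b)" by fastforce
  have bounds: "1 \<le> a" "a \<le> n" "b < n" "(a, b) \<noteq> (n, 0)"
    using i(1) ab by (auto simp: monomial_indices_def)
  show ?thesis
  proof (cases g)
    case Clock
    \<comment> \<open>The automatic brackets with \<open>D\<close>: \<open>[D, D] = 0\<close>,
      \<open>[D, S] = - [S, D]\<close>, and those defining a lift.\<close>
    consider "a = 1" "b = 0" | "a = n" "b = 1" | "0 < b" "a < n" "(a, b) \<noteq> (n - 1, 1)"
      using i(2) ab bounds Clock by (fastforce simp: relation_indices_def)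
    then show ?thesis
    proof cases
      case 1
      then show ?thesis using Clock ab eqs(1) fl.span_zero by simp
    next
      case 2
      have "ad_clock (fl_gen Shift) = - ad_shift (monomial_lift n (1, 0))"
        unfolding eqs(1) by (rule fl_bracket_anticommute)
      also have "\<dots> = - monomial_lift n (1, 1)"
        using eqs(3)[of 0] n by simp
      finally have "ad_clock (monomial_lift n i) = - monomial_lift n (1, 1)"
        using 2 ab eqs(2) by simp
      moreover have "(1, 1) \<in> monomial_indices n"
        using n by (simp add: monomial_indices_def)
      ultimately show ?thesis using Clock fl.span_neg[OF base] by metis
    next
      case 3
      then have "(a + 1, b) \<in> monomial_indices n"
        using bounds by (simp add: monomial_indices_def)
      then show ?thesis
        using 3 bounds Clock ab eqs(4)[of a b] base[of "(a + 1, b)"] by simp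
    qed
  next
    case Shift
    \<comment> \<open>The automatic brackets with \<open>S\<close>: first and third define a lift,
      second is \<open>[S, S] = 0\<close>, fourth is the Leibniz coincidence.\<close>
    consider "a = 1" "b < n - 1" | "a = n" "b = 1" | "2 \<le> a" "a < n" "b = n - 1"
      | "n \<ge> 3" "a = 2" "b = 1"
      using i(2) ab bounds Shift n
      by (cases "a = 1"; cases "a = n"; cases "b = n - 1") (auto simp: relation_indices_def)
    then show ?thesis
    proof cases
      case 1
      then have "(1, b + 1) \<in> monomial_indices n"
        using n by (simp add: monomial_indices_def)
      then show ?thesis
        using 1 Shift ab eqs(3)[of b] base[of "(1, b + 1)"] by simp
    next
      case 2
      then show ?thesis using Shift ab eqs(2) fl.span_zero by simp
    next
      case 3
      then have "(a, 0) \<in> monomial_indices n"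
        by (simp add: monomial_indices_def)
      then show ?thesis
        using 3 Shift ab eqs(5)[of a] base[of "(a, 0)"] by simp
    next
      case 4
      then have "(2, 2) \<in> monomial_indices n"
        by (simp add: monomial_indices_def)
      then show ?thesis
        using 4 Shift ab ad_shift_monomial_lift_2_1 base[of "(2, 2)"] by metis
    qed
  qed
qed

section \<open>The images of the lifts in \<open>sl n\<close>\<close>

lemma free_lie_hom_is_lie_hom:
  fixes f :: "'g \<Rightarrow> 'b" and L :: "('k::field, 'b, 'd) lie_algebra_scheme"
  assumes "lie_algebra class_ring L" "range f \<subseteq> carrier L"
  shows "lie_hom class_ring free_lie_algebra L (free_lie_hom L f)"
    and "free_lie_hom L f (fl_gen g) = f g"
  using theI'[OF free_lie_algebra_universal[OF assms]] unfolding free_lie_hom_def by blast+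

lemma smult_smult_mat: "a \<cdot>\<^sub>m (b \<cdot>\<^sub>m A) = (a * b :: 'a::semigroup_mult) \<cdot>\<^sub>m A"
  by (intro eq_matI) (simp_all add: mult.assoc)

lemma one_smult_mat: "1 \<cdot>\<^sub>m A = (A :: 'a::monoid_mult mat)"
  by (intro eq_matI) simp_all

context
  fixes n :: nat and h :: "(complex, clock_shift) free_lie \<Rightarrow> complex mat"
  assumes n: "n \<ge> 2"
  defines "h \<equiv> free_lie_hom (sl n) (clock_shift_mat n)"
begin

lemma clock_shift_hom: "lie_hom class_ring free_lie_algebra (sl n) h"
  unfolding h_def using lie_algebra_sl clock_shift_mat_in_sl[OF n]
  by (intro free_lie_hom_is_lie_hom) auto

lemma clock_shift_hom_gen: "h (fl_gen g) = clock_shift_mat n g"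
  unfolding h_def using lie_algebra_sl clock_shift_mat_in_sl[OF n]
  by (intro free_lie_hom_is_lie_hom) auto

lemma clock_shift_hom_simps:
  shows clock_shift_hom_carrier: "h x \<in> carrier_mat n n"
    and clock_shift_hom_zero: "h 0 = 0\<^sub>m n n"
    and clock_shift_hom_add: "h (x + y) = h x + h y"
    and clock_shift_hom_smult: "h (fl_smult c x) = c \<cdot>\<^sub>m h x"
    and clock_shift_hom_bracket: "h (fl_bracket x y) = h x * h y - h y * h x"
proof -
  interpret h: lie_hom class_ring free_lie_algebra "sl n" h by (rule clock_shift_hom)
  show "h x \<in> carrier_mat n n" using h.f_im by auto
  show "h 0 = 0\<^sub>m n n" using h.f0_is_0 by (simp add: zero_free_lie_def)
  show "h (x + y) = h x + h y" using h.f_add[of x y] by (simp add: plus_free_lie_def)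
  show "h (fl_smult c x) = c \<cdot>\<^sub>m h x" using h.f_smult[of c x] by simp
  show "h (fl_bracket x y) = h x * h y - h y * h x" using h.hom_bracket[of x y] by simp
qed

lemma clock_shift_hom_sum:
  assumes "finite I" "i < n" "j < n"
  shows "h (\<Sum>p\<in>I. fl_smult (u p) (t p)) $$ (i, j) = (\<Sum>p\<in>I. u p * h (t p) $$ (i, j))"
  using assms(1)
proof induction
  case empty
  then show ?case using assms(2,3) by (simp add: clock_shift_hom_zero)
next
  case (insert p I)
  have "h (t p) \<in> carrier_mat n n" "h (\<Sum>p\<in>I. fl_smult (u p) (t p)) \<in> carrier_mat n n"
    by (rule clock_shift_hom_carrier)+
  with insert show ?case
    using assms(2,3) by (simp add: clock_shift_hom_add clock_shift_hom_smult)
qed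

lemma monomial_bracket_smult:
  "clock_shift_monomial n a b * (c \<cdot>\<^sub>m clock_shift_monomial n a' b')
     - (c \<cdot>\<^sub>m clock_shift_monomial n a' b') * clock_shift_monomial n a b =
   (c * (unity_root n ^ (b * a') - unity_root n ^ (b' * a))) \<cdot>\<^sub>m clock_shift_monomial n (a + a') (b + b')"
proof -
  have "clock_shift_monomial n a b * (c \<cdot>\<^sub>m clock_shift_monomial n a' b')
     - (c \<cdot>\<^sub>m clock_shift_monomial n a' b') * clock_shift_monomial n a b =
     c \<cdot>\<^sub>m (clock_shift_monomial n a b * clock_shift_monomial n a' b'
       - clock_shift_monomial n a' b' * clock_shift_monomial n a b)"
    by (intro eq_matI) (simp_all add: mult_smult_distrib[of _ n n] mult_smult_assoc_mat[of _ n n]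
        algebra_simps)
  then show ?thesis
    by (simp add: clock_shift_monomial_bracket smult_smult_mat)
qed

text \<open>The new factor vanishes exactly when \<open>n\<close> divides \<open>b\<close>; its
  counterpart for \<open>S\<close> vanishes exactly when \<open>n\<close> divides
  \<open>a\<close>.\<close>

lemma hom_ad_clock:
  assumes "h x = c \<cdot>\<^sub>m clock_shift_monomial n a b"
  shows "h (ad_clock x) = (c * (1 - unity_root n ^ b)) \<cdot>\<^sub>m clock_shift_monomial n (a + 1) b"
  using monomial_bracket_smult[of 1 0 c a b] assms
  by (simp add: clock_shift_hom_bracket clock_shift_hom_gen clock_mat_monomial)

lemma hom_ad_shift:
  assumes "h x = c \<cdot>\<^sub>m clock_shift_monomial n a b"
  shows "h (ad_shift x) = (c * (unity_root n ^ a - 1)) \<cdot>\<^sub>m clock_shift_monomial n a (b + 1)"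
  using monomial_bracket_smult[of 0 1 c a b] assms
  by (simp add: clock_shift_hom_bracket clock_shift_hom_gen shift_mat_monomial)

text \<open>The scalar is a product of factors \<open>unity_root n ^ a - 1\<close> and
  \<open>1 - unity_root n ^ b\<close>. The route to each lift takes only steps with
  \<open>0 < a < n\<close> or \<open>0 < b < n\<close> respectively, so none of them
  vanishes.\<close>

lemma hom_monomial_lift:
  assumes "(a, b) \<in> monomial_indices n"
  obtains c where "c \<noteq> 0" "h (monomial_lift n (a, b)) = c \<cdot>\<^sub>m clock_shift_monomial n a b"
proof -
  have bounds: "1 \<le> a" "a \<le> n" "b < n" "(a, b) \<noteq> (n, 0)"
    using assms by (auto simp: monomial_indices_def)
  have nz: "unity_root n ^ k \<noteq> 1" if "0 < k" "k < n" for k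
    using that n unity_root_pow_eq_1_iff[of n k] nat_dvd_not_less by auto
  have shifts: "\<exists>c. c \<noteq> 0 \<and> h ((ad_shift ^^ k) (fl_gen Clock)) = c \<cdot>\<^sub>m clock_shift_monomial n 1 k" for k
  proof (induction k)
    case 0
    show ?case
      by (intro exI[of _ 1]) (simp add: clock_shift_hom_gen clock_mat_monomial one_smult_mat)
  next
    case (Suc k)
    then obtain c where c: "c \<noteq> 0"
        "h ((ad_shift ^^ k) (fl_gen Clock)) = c \<cdot>\<^sub>m clock_shift_monomial n 1 k"
      by blast
    show ?case
      using hom_ad_shift[OF c(2)] c(1) nz[of 1] n
      by (intro exI[of _ "c * (unity_root n ^ 1 - 1)"]) simp
  qed
  have clocks: "\<exists>c. c \<noteq> 0 \<and> h ((ad_clock ^^ m) ((ad_shift ^^ k) (fl_gen Clock))) =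
      c \<cdot>\<^sub>m clock_shift_monomial n (m + 1) k" if "0 < k" "k < n" for m k
  proof (induction m)
    case 0
    show ?case using shifts[of k] by simp
  next
    case (Suc m)
    then obtain c where c: "c \<noteq> 0" "h ((ad_clock ^^ m) ((ad_shift ^^ k) (fl_gen Clock))) =
        c \<cdot>\<^sub>m clock_shift_monomial n (m + 1) k"
      by blast
    show ?case
      using hom_ad_clock[OF c(2)] c(1) nz[OF that]
      by (intro exI[of _ "c * (1 - unity_root n ^ k)"]) simp
  qed
  have "\<exists>c. c \<noteq> 0 \<and> h (monomial_lift n (a, b)) = c \<cdot>\<^sub>m clock_shift_monomial n a b"
  proof -
    consider "b = 0" "a = 1" | "b = 0" "2 \<le> a" "a < n" | "b = 1" "a = n" | "0 < b" "(a, b) \<noteq> (n, 1)"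
      using bounds by fastforce
    then show ?thesis
    proof cases
      case 1
      then show ?thesis using shifts[of 0] by simp
    next
      case 2
      let ?x = "(ad_clock ^^ (a - 1)) ((ad_shift ^^ (n - 1)) (fl_gen Clock))"
      obtain c where c: "c \<noteq> 0" "h ?x = c \<cdot>\<^sub>m clock_shift_monomial n a (n - 1)"
        using clocks[of "n - 1" "a - 1"] n 2 by auto
      \<comment> \<open>The last \<open>ad S\<close> raises the exponent of \<open>S\<close> to
        \<open>n\<close>, which counts as \<open>0\<close>.\<close>
      have "clock_shift_monomial n a n = clock_shift_monomial n a 0"
        using n by (intro clock_shift_monomial_cong) auto
      then show ?thesis
        using hom_ad_shift[OF c(2)] c(1) 2 n nz[of a]
        by (intro exI[of _ "c * (unity_root n ^ a - 1)"]) simp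
    next
      case 3
      moreover have "clock_shift_monomial n 0 1 = clock_shift_monomial n n 1"
        using n by (intro clock_shift_monomial_cong) auto
      ultimately show ?thesis
        using n by (intro exI[of _ 1]) (simp add: clock_shift_hom_gen shift_mat_monomial one_smult_mat)
    next
      case 4
      then show ?thesis using clocks[of b "a - 1"] bounds by auto
    qed
  qed
  then show ?thesis using that by blast
qed

text \<open>The bracket is a multiple of the monomial at a neighbouring index. The missing index
  \<open>(n, 0)\<close>, the identity matrix, would be hit only from \<open>b = 0\<close> by
  \<open>D\<close> or from \<open>a = n\<close> by \<open>S\<close>, and there the factor is
  zero.\<close>

lemma hom_bracket_gen_lift:
  assumes i: "i \<in> monomial_indices n"
  shows "\<exists>y\<in>fl.span (monomial_lift n ` monomial_indices n).
    h y = h (fl_bracket (fl_gen g) (monomial_lift n i))"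
proof -
  let ?V = "fl.span (monomial_lift n ` monomial_indices n)"
  have zero: "\<exists>y\<in>?V. h y = 0 \<cdot>\<^sub>m clock_shift_monomial n a b" for a b
    by (intro bexI[of _ 0] fl.span_zero) (auto simp: clock_shift_hom_zero intro!: eq_matI)
  \<comment> \<open>Any multiple of a monomial is attained by rescaling its lift. The congruences
    let exponents that wrap around be replaced by their representatives in the index set.\<close>
  have mono: "\<exists>y\<in>?V. h y = d \<cdot>\<^sub>m clock_shift_monomial n a' b'"
    if mem: "(a, b) \<in> monomial_indices n" and "a' mod n = a mod n" "b' mod n = b mod n" for a b a' b' d
  proof -
    obtain c where c: "c \<noteq> 0" "h (monomial_lift n (a, b)) = c \<cdot>\<^sub>m clock_shift_monomial n a b"
      by (rule hom_monomial_lift[OF mem])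
    have "clock_shift_monomial n a' b' = clock_shift_monomial n a b"
      using n that by (intro clock_shift_monomial_cong) auto
    then show ?thesis
      using mem c
      by (intro bexI[of _ "fl_smult (d / c) (monomial_lift n (a, b))"] fl.span_scale fl.span_base imageI)
        (simp_all add: clock_shift_hom_smult smult_smult_mat del: monomial_lift.simps)
  qed
  obtain a b where ab: "i = (a, b)" by fastforce
  then have bounds: "1 \<le> a" "a \<le> n" "b < n" "(a, b) \<noteq> (n, 0)"
    using i by (auto simp: monomial_indices_def)
  obtain c where c: "h (monomial_lift n i) = c \<cdot>\<^sub>m clock_shift_monomial n a b"
    unfolding ab by (rule hom_monomial_lift[OF i[unfolded ab]])
  show ?thesis
  proof (cases g)
    case Clock
    show ?thesis
    proof (cases "b = 0")
      case True
      then show ?thesis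
        using hom_ad_clock[OF c] zero Clock by simp
    next
      case False
      have "\<exists>y\<in>?V. h y = (c * (1 - unity_root n ^ b)) \<cdot>\<^sub>m clock_shift_monomial n (a + 1) b"
      proof (rule mono)
        show "(if a = n then 1 else a + 1, b) \<in> monomial_indices n"
          using bounds n False by (simp add: monomial_indices_def)
        show "(a + 1) mod n = (if a = n then 1 else a + 1) mod n"
          by (simp add: mod_Suc)
      qed (rule HOL.refl)
      then show ?thesis
        using hom_ad_clock[OF c] Clock by simp
    qed
  next
    case Shift
    show ?thesis
    proof (cases "a = n")
      case True
      then have "unity_root n ^ a = 1"
        using unity_root_pow_eq_1_iff[of n n] n by simp
      then show ?thesis
        using hom_ad_shift[OF c] zero Shift by simp
    next
      case False
      have "\<exists>y\<in>?V. h y = (c * (unity_root n ^ a - 1)) \<cdot>\<^sub>m clock_shift_monomial n a (b + 1)"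
      proof (rule mono)
        show "(a, (b + 1) mod n) \<in> monomial_indices n"
          using bounds n False by (simp add: monomial_indices_def)
      qed simp_all
      then show ?thesis
        using hom_ad_shift[OF c] Shift by simp
    qed
  qed
qed

text \<open>Linear independence of the monomials: the entries at \<open>(i, (i + b) mod n)\<close>
  isolate the terms with exponent \<open>b\<close> of \<open>S\<close>, and Fourier inversion over
  \<open>i\<close> then separates the exponents of \<open>D\<close>.\<close>

lemma hom_inj_on_lift_span:
  assumes x: "x \<in> fl.span (monomial_lift n ` monomial_indices n)" and hx: "h x = 0\<^sub>m n n"
  shows "x = 0"
proof -
  let ?t = "monomial_lift n" and ?I = "monomial_indices n"
  have fin: "finite ?I" by (simp add: monomial_indices_def)
  \<comment> \<open>Coefficients are attached to indices rather than to lifts, so injectivity of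
    \<open>?t\<close> need not be known.\<close>
  define S where "S = range (\<lambda>u. \<Sum>p\<in>?I. fl_smult (u p) (?t p))"
  have "fl.subspace S"
    unfolding fl.subspace_def
  proof (intro conjI ballI allI)
    have "0 = (\<Sum>p\<in>?I. fl_smult 0 (?t p))" by simp
    then show "0 \<in> S" unfolding S_def by (rule range_eqI[where x = "\<lambda>_. 0"])
  next
    fix x y assume "x \<in> S" "y \<in> S"
    then obtain u v where "x = (\<Sum>p\<in>?I. fl_smult (u p) (?t p))" "y = (\<Sum>p\<in>?I. fl_smult (v p) (?t p))"
      by (auto simp: S_def)
    then have "x + y = (\<Sum>p\<in>?I. fl_smult (u p + v p) (?t p))"
      by (simp add: sum.distrib fl.scale_left_distrib)
    then show "x + y \<in> S" unfolding S_def by (rule range_eqI[where x = "\<lambda>p. u p + v p"])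
  next
    fix c x assume "x \<in> S"
    then obtain u where "x = (\<Sum>p\<in>?I. fl_smult (u p) (?t p))" by (auto simp: S_def)
    then have "fl_smult c x = (\<Sum>p\<in>?I. fl_smult (c * u p) (?t p))"
      by (simp add: fl.scale_sum_right)
    then show "fl_smult c x \<in> S" unfolding S_def by (rule range_eqI[where x = "\<lambda>p. c * u p"])
  qed
  moreover have "?t ` ?I \<subseteq> S"
  proof
    fix y assume "y \<in> ?t ` ?I"
    then obtain q where q: "q \<in> ?I" "y = ?t q" by auto
    have "(\<Sum>p\<in>?I. fl_smult (if p = q then 1 else 0) (?t p)) = (\<Sum>p\<in>?I. if p = q then ?t q else 0)"
      by (intro sum.cong) auto
    then have "y = (\<Sum>p\<in>?I. fl_smult (if p = q then 1 else 0) (?t p))"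
      using q fin by simp
    then show "y \<in> S" unfolding S_def by (rule range_eqI[where x = "\<lambda>p. if p = q then 1 else 0"])
  qed
  ultimately have "fl.span (?t ` ?I) \<subseteq> S" by (metis fl.span_minimal)
  then obtain u where u: "x = (\<Sum>p\<in>?I. fl_smult (u p) (?t p))"
    using x by (auto simp: S_def)
  have "\<forall>p\<in>?I. \<exists>c. c \<noteq> 0 \<and> h (?t p) = c \<cdot>\<^sub>m clock_shift_monomial n (fst p) (snd p)"
  proof
    fix p assume "p \<in> ?I"
    then have "(fst p, snd p) \<in> ?I" by simp
    then obtain c where "c \<noteq> 0" "h (?t (fst p, snd p)) = c \<cdot>\<^sub>m clock_shift_monomial n (fst p) (snd p)"
      by (rule hom_monomial_lift)
    then show "\<exists>c. c \<noteq> 0 \<and> h (?t p) = c \<cdot>\<^sub>m clock_shift_monomial n (fst p) (snd p)"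
      unfolding prod.collapse by blast
  qed
  then obtain c where c: "\<And>p. p \<in> ?I \<Longrightarrow> c p \<noteq> 0"
      "\<And>p. p \<in> ?I \<Longrightarrow> h (?t p) = c p \<cdot>\<^sub>m clock_shift_monomial n (fst p) (snd p)"
    by metis
  \<comment> \<open>\<open>v\<close> absorbs the scalars \<open>c\<close> and extends by zero to
    \<open>(n, 0)\<close>, so that the sums run over the full rectangle.\<close>
  define v where "v p = (if p \<in> ?I then u p * c p else 0)" for p
  have "v (a, b) = 0" if ab: "a \<in> {1..n}" "b < n" for a b
  proof (rule unity_root_fourier_zero[where u = "\<lambda>a. v (a, b)" and n = n])
    fix i assume i: "i < n"
    let ?j = "(i + b) mod n"
    have eq: "?j = (i + b') mod n \<longleftrightarrow> b' = b" if "b' < n" for b'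
      using that i \<open>b < n\<close> by (auto simp: mod_if)
    have "0 = h x $$ (i, ?j)"
      using hx i by simp
    also have "\<dots> = (\<Sum>p\<in>?I. u p * h (?t p) $$ (i, ?j))"
      unfolding u using fin i by (intro clock_shift_hom_sum) auto
    also have "\<dots> = (\<Sum>p\<in>?I. v p * (if snd p = b then unity_root n ^ (fst p * i) else 0))"
      using i by (intro sum.cong)
        (auto simp: v_def c eq clock_shift_monomial_def monomial_indices_def simp del: monomial_lift.simps)
    also have "\<dots> = (\<Sum>p\<in>{1..n} \<times> {..<n}. v p * (if snd p = b then unity_root n ^ (fst p * i) else 0))"
      by (intro sum.mono_neutral_left) (auto simp: v_def monomial_indices_def)
    also have "\<dots> = (\<Sum>a=1..n. \<Sum>b'<n. v (a, b') * (if b' = b then unity_root n ^ (a * i) else 0))"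
      by (simp add: sum.cartesian_product split_def)
    also have "\<dots> = (\<Sum>a=1..n. v (a, b) * unity_root n ^ (a * i))"
      using ab(2) by (intro sum.cong HOL.refl) (simp add: if_distrib cong: if_cong)
    finally show "(\<Sum>a=1..n. v (a, b) * unity_root n ^ (a * i)) = 0" by simp
  qed (use n ab in auto)
  then have "u p = 0" if "p \<in> ?I" for p
    using that c(1)[OF that] by (cases p) (fastforce simp: v_def monomial_indices_def split: if_splits)
  then show "x = 0"
    by (simp add: u)
qed

end

theorem theorem2p5:
  fixes n :: nat
  assumes "n \<ge> 2"
  shows "num_relations n \<le> (if n = 2 then 2 else enat (n\<^sup>2 - 3))"
proof -
  \<comment> \<open>Every listed pair has its index in the index set, so the bracket computation in
    \<open>sl n\<close> supplies the correction for each relation.\<close>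
  have sub: "relation_indices n \<subseteq> UNIV \<times> monomial_indices n"
    using assms by (auto simp: relation_indices_def monomial_indices_def)
  have gens: "fl_gen g \<in> fl.span (monomial_lift n ` monomial_indices n)" for g
  proof (cases g)
    case Clock
    have "(1, 0) \<in> monomial_indices n" using assms by (simp add: monomial_indices_def)
    then show ?thesis
      using Clock monomial_lift_eqs(1)[OF assms] fl.span_base by (metis imageI)
  next
    case Shift
    have "(n, 1) \<in> monomial_indices n" using assms by (simp add: monomial_indices_def)
    then show ?thesis
      using Shift monomial_lift_eqs(2)[OF assms] fl.span_base by (metis imageI)
  qed
  have "num_relations n \<le> enat (card (relation_indices n))"
    unfolding num_relations_def clock_shift_relations_def
  proof (rule min_ideal_generators_ker_le[where t = "monomial_lift n" and I = "monomial_indices n"])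
    fix g i assume "(g, i) \<in> relation_indices n"
    then show "\<exists>y\<in>fl.span (monomial_lift n ` monomial_indices n).
      free_lie_hom (sl n) (clock_shift_mat n) y =
      free_lie_hom (sl n) (clock_shift_mat n) (fl_bracket (fl_gen g) (monomial_lift n i))"
      using hom_bracket_gen_lift[OF assms] sub by blast
  qed (use gens clock_shift_hom[OF assms] hom_inj_on_lift_span[OF assms]
      fl_bracket_gen_lift_in_span[OF assms] finite_relation_indices in \<open>auto simp del: monomial_lift.simps\<close>)
  also have "\<dots> \<le> enat (if n = 2 then 2 else n\<^sup>2 - 3)"
    using card_relation_indices[OF assms] by simp
  finally show ?thesis
    by (simp add: numeral_eq_enat split: if_splits)
qed

end
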